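(* Let $\ell_1,\ell_2\ge1$ and $\sigma\ge4$ be integers, let $D=\{(X_1,Y_1),\ldots,(X_\sigma,Y_\sigma)\}$ be a dataset with values in $[\ell_1]\times[\ell_2]$, and let $\boldsymbol\eta=\{\eta_1,\ldots,\eta_{\ell_1}\}$ and $\boldsymbol\upsilon=\{\upsilon_1,\ldots,\upsilon_{\ell_2}\}$ be real weight vectors with non-zero components. Then the U-statistic $U_W^{\boldsymbol\eta,\boldsymbol\upsilon}(D)$ can be written as $$U_W^{\boldsymbol\eta,\boldsymbol\upsilon}(D)=\frac{1}{\sigma(\sigma-3)}\Big[A_1+\frac{1}{(\sigma-1)(\sigma-2)}A_2-\frac{2}{\sigma-2}A_3\Big],$$ where $$A_1=\sum_{q=1}^{\ell_1}\sum_{r=1}^{\ell_2}\frac{o_{qr}^2-o_{qr}}{\eta_q\upsilon_r},\qquad A_2=\sum_{q=1}^{\ell_1}\frac{o_{q+}^2-o_{q+}}{\eta_q}\cdot\sum_{r=1}^{\ell_2}\frac{o_{+r}^2-o_{+r}}{\upsilon_r},$$ $$A_3=\sum_{q=1}^{\ell_1}\sum_{r=1}^{\ell_2}\frac{o_{qr}(o_{q+}o_{+r}-o_{q+}-o_{+r}+1)}{\eta_q\upsilon_r}.$$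
   Context: $[a]=\{1,\ldots,a\}$ and $\mathbf 1(\cdot)$ is an indicator. Define $\phi_{ij}(qr)=\mathbf 1(X_i=q)\mathbf 1(Y_i=r)-\mathbf 1(X_i=q)\mathbf 1(Y_j=r)$. For distinct $i,j,k,l\in[\sigma]$, $$h_{ijkl}^{\boldsymbol\eta,\boldsymbol\upsilon}=\frac1{4!}\sum_{(\pi_1,\pi_2,\pi_3,\pi_4)}\ \sum_{q\in[\ell_1],r\in[\ell_2]}\frac{\phi_{\pi_1\pi_2}(qr)\phi_{\pi_3\pi_4}(qr)}{\eta_q\upsilon_r},$$ the outer sum being over all $4!$ permutations of $(i,j,k,l)$, and $$U_W^{\boldsymbol\eta,\boldsymbol\upsilon}(D)=\binom{\sigma}{4}^{-1}\sum_{1\le i<j<k<l\le\sigma}h_{ijkl}^{\boldsymbol\eta,\boldsymbol\upsilon}.$$ Contingency-table counts: $o_{qr}=\sum_{i=1}^\sigma\mathbf 1(X_i=q)\mathbf 1(Y_i=r)$, $o_{q+}=\sum_{r=1}^{\ell_2}o_{qr}$, $o_{+r}=\sum_{q=1}^{\ell_1}o_{qr}$. *)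

theory Defs
  imports Complex_Main "HOL-Combinatorics.Permutations"
begin

text \<open>
  A dataset of size \<open>\<sigma>\<close> is given by its two coordinate sequences \<open>X, Y\<close>, of which only the
  values at the indices \<open>1, \<dots>, \<sigma>\<close> are used; the categories are \<open>{1..l1}\<close> and \<open>{1..l2}\<close>.
  A weight vector is a function on indices; only its values on \<open>{1..l1}\<close>, respectively
  \<open>{1..l2}\<close>, are used.
\<close>

definition phi :: "(nat \<Rightarrow> nat) \<Rightarrow> (nat \<Rightarrow> nat) \<Rightarrow> nat \<Rightarrow> nat \<Rightarrow> nat \<Rightarrow> nat \<Rightarrow> real" where
  "phi X Y i j q r =
     of_bool (X i = q) * of_bool (Y i = r) - of_bool (X i = q) * of_bool (Y j = r)"

text \<open>
  The permutations \<open>(\<pi>\<^sub>1, \<pi>\<^sub>2, \<pi>\<^sub>3, \<pi>\<^sub>4)\<close> of \<open>(i, j, k, l)\<close> are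
  \<open>(\<pi> i, \<pi> j, \<pi> k, \<pi> l)\<close> for the bijections \<open>\<pi>\<close> of \<open>{i, j, k, l}\<close>. The kernel is meaningful only
  for pairwise distinct \<open>i, j, k, l\<close>, where there are \<open>4!\<close> of them.
\<close>

definition kernel_h ::
  "nat \<Rightarrow> nat \<Rightarrow> (nat \<Rightarrow> nat) \<Rightarrow> (nat \<Rightarrow> nat) \<Rightarrow> (nat \<Rightarrow> real) \<Rightarrow> (nat \<Rightarrow> real)
    \<Rightarrow> nat \<Rightarrow> nat \<Rightarrow> nat \<Rightarrow> nat \<Rightarrow> real" where
  "kernel_h l1 l2 X Y \<eta> \<upsilon> i j k l =
     1 / fact 4 *
     (\<Sum>\<pi> | \<pi> permutes {i, j, k, l}. \<Sum>q\<in>{1..l1}. \<Sum>r\<in>{1..l2}.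
        phi X Y (\<pi> i) (\<pi> j) q r * phi X Y (\<pi> k) (\<pi> l) q r / (\<eta> q * \<upsilon> r))"

definition U_W ::
  "nat \<Rightarrow> nat \<Rightarrow> nat \<Rightarrow> (nat \<Rightarrow> nat) \<Rightarrow> (nat \<Rightarrow> nat) \<Rightarrow> (nat \<Rightarrow> real) \<Rightarrow> (nat \<Rightarrow> real) \<Rightarrow> real" where
  "U_W \<sigma> l1 l2 X Y \<eta> \<upsilon> =
     inverse (real (\<sigma> choose 4)) *
     (\<Sum>(i, j, k, l) \<in> {(i, j, k, l). 1 \<le> i \<and> i < j \<and> j < k \<and> k < l \<and> l \<le> \<sigma>}.
        kernel_h l1 l2 X Y \<eta> \<upsilon> i j k l)"

definition cell_count :: "nat \<Rightarrow> (nat \<Rightarrow> nat) \<Rightarrow> (nat \<Rightarrow> nat) \<Rightarrow> nat \<Rightarrow> nat \<Rightarrow> real" where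
  "cell_count \<sigma> X Y q r = (\<Sum>i=1..\<sigma>. of_bool (X i = q) * of_bool (Y i = r))"

definition row_count :: "nat \<Rightarrow> nat \<Rightarrow> (nat \<Rightarrow> nat) \<Rightarrow> (nat \<Rightarrow> nat) \<Rightarrow> nat \<Rightarrow> real" where
  "row_count \<sigma> l2 X Y q = (\<Sum>r=1..l2. cell_count \<sigma> X Y q r)"

definition col_count :: "nat \<Rightarrow> nat \<Rightarrow> (nat \<Rightarrow> nat) \<Rightarrow> (nat \<Rightarrow> nat) \<Rightarrow> nat \<Rightarrow> real" where
  "col_count \<sigma> l1 X Y r = (\<Sum>q=1..l1. cell_count \<sigma> X Y q r)"

definition A1 ::
  "nat \<Rightarrow> nat \<Rightarrow> nat \<Rightarrow> (nat \<Rightarrow> nat) \<Rightarrow> (nat \<Rightarrow> nat) \<Rightarrow> (nat \<Rightarrow> real) \<Rightarrow> (nat \<Rightarrow> real) \<Rightarrow> real" where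
  "A1 \<sigma> l1 l2 X Y \<eta> \<upsilon> =
     (\<Sum>q=1..l1. \<Sum>r=1..l2.
        ((cell_count \<sigma> X Y q r)\<^sup>2 - cell_count \<sigma> X Y q r) / (\<eta> q * \<upsilon> r))"

definition A2 ::
  "nat \<Rightarrow> nat \<Rightarrow> nat \<Rightarrow> (nat \<Rightarrow> nat) \<Rightarrow> (nat \<Rightarrow> nat) \<Rightarrow> (nat \<Rightarrow> real) \<Rightarrow> (nat \<Rightarrow> real) \<Rightarrow> real" where
  "A2 \<sigma> l1 l2 X Y \<eta> \<upsilon> =
     (\<Sum>q=1..l1. ((row_count \<sigma> l2 X Y q)\<^sup>2 - row_count \<sigma> l2 X Y q) / \<eta> q) *
     (\<Sum>r=1..l2. ((col_count \<sigma> l1 X Y r)\<^sup>2 - col_count \<sigma> l1 X Y r) / \<upsilon> r)"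

definition A3 ::
  "nat \<Rightarrow> nat \<Rightarrow> nat \<Rightarrow> (nat \<Rightarrow> nat) \<Rightarrow> (nat \<Rightarrow> nat) \<Rightarrow> (nat \<Rightarrow> real) \<Rightarrow> (nat \<Rightarrow> real) \<Rightarrow> real" where
  "A3 \<sigma> l1 l2 X Y \<eta> \<upsilon> =
     (\<Sum>q=1..l1. \<Sum>r=1..l2.
        cell_count \<sigma> X Y q r *
        (row_count \<sigma> l2 X Y q * col_count \<sigma> l1 X Y r
           - row_count \<sigma> l2 X Y q - col_count \<sigma> l1 X Y r + 1) / (\<eta> q * \<upsilon> r))"

end

theory Submission
  imports Defs
begin

text \<open>
  The kernel averages over all orderings of four indices, so \<open>U_W\<close> is the average of
  \<open>\<Sum>q r. \<phi>\<^sub>i\<^sub>j(qr) \<phi>\<^sub>k\<^sub>l(qr) / (\<eta>\<^sub>q \<upsilon>\<^sub>r)\<close> over the \<open>\<sigma>(\<sigma>-1)(\<sigma>-2)(\<sigma>-3)\<close> ordered quadruples of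
  distinct indices: each of them is uniquely a permutation of an increasing one
  (\<open>sum_increasing_quadruples_permutes\<close>). It remains to compute, for one cell \<open>(q, r)\<close>, the sum of
  \<open>\<phi>\<^sub>i\<^sub>j \<phi>\<^sub>k\<^sub>l\<close> over these quadruples.

  With \<open>a\<^sub>i = 1(X\<^sub>i = q)\<close> and \<open>b\<^sub>i = 1(Y\<^sub>i = r)\<close> we have \<open>\<phi>\<^sub>i\<^sub>j = a\<^sub>i b\<^sub>i - a\<^sub>i b\<^sub>j\<close>, which vanishes for
  \<open>i = j\<close>. Hence only the disjointness of \<open>{i, j}\<close> and \<open>{k, l}\<close> is a genuine constraint, and the
  sum over \<open>k, l\<close> can be evaluated first, as the full sum corrected by the terms at \<open>i\<close> and \<open>j\<close>.
  Since \<open>a\<^sub>i\<^sup>2 = a\<^sub>i\<close> and \<open>b\<^sub>i\<^sup>2 = b\<^sub>i\<close>, what is left is a combination of sums of monomials in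
  \<open>a\<^sub>i, b\<^sub>i, a\<^sub>j, b\<^sub>j\<close>, all of which are products of the sample size, the two marginal counts and
  the cell count (\<open>sum_distinct_quadruples_indicator_kernel\<close>). The three groups of terms in the
  result, weighted and summed over the cells, are multiples of \<open>A1\<close>, \<open>A2\<close> and \<open>A3\<close>.
\<close>

section \<open>Ordered quadruples and permutations of increasing quadruples\<close>

definition distinct_quadruples :: "'a set \<Rightarrow> ('a \<times> 'a \<times> 'a \<times> 'a) set" where
  "distinct_quadruples S = {(i, j, k, l). {i, j, k, l} \<subseteq> S \<and> distinct [i, j, k, l]}"

lemma ex_sorted_quadruple:
  fixes T :: "'a::linorder set"
  assumes "card T = 4"
  obtains i j k l where "i < j" "j < k" "k < l" "T = {i, j, k, l}"
proof -
  have fin: "finite T"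
    using assms by (simp add: card_ge_0_finite)
  define xs where "xs = sorted_list_of_set T"
  have "length xs = 4" "sorted_wrt (<) xs" "set xs = T"
    using assms fin by (simp_all add: xs_def sorted_list_of_set.finite_set_strict_sorted)
  then show thesis
    by (auto simp: numeral_eq_Suc length_Suc_conv intro!: that)
qed

lemma permutation_of_distinct_quadruple:
  assumes "distinct [i, j, k, l]" and "distinct [a, b, c, d]" and "{a, b, c, d} = {i, j, k, l}"
  obtains \<pi> where "\<pi> permutes {i, j, k, l}" "\<pi> i = a" "\<pi> j = b" "\<pi> k = c" "\<pi> l = d"
proof -
  define \<pi> where
    "\<pi> = (\<lambda>x. if x = i then a else if x = j then b else if x = k then c else if x = l then d else x)"
  have val: "\<pi> i = a" "\<pi> j = b" "\<pi> k = c" "\<pi> l = d"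
    using assms(1) by (auto simp: \<pi>_def)
  have "inj_on \<pi> {i, j, k, l}"
    using assms(2) val by (auto simp: inj_on_def)
  moreover have "\<pi> ` {i, j, k, l} = {i, j, k, l}"
    using assms(3) val by simp
  ultimately have "\<pi> permutes {i, j, k, l}"
    by (intro bij_imp_permutes) (auto simp: bij_betw_def \<pi>_def)
  with val show thesis
    by (rule that[rotated 1])
qed

text \<open>
  The map \<open>((i, j, k, l), \<pi>) \<mapsto> (\<pi> i, \<pi> j, \<pi> k, \<pi> l)\<close> is a bijection: the set of entries of the image
  is \<open>{i, j, k, l}\<close>, which determines the increasing quadruple, and then the entries determine \<open>\<pi>\<close>
  on that set, outside of which it is the identity.
\<close>

lemma sum_increasing_quadruples_permutes:
  fixes g :: "'a::linorder \<Rightarrow> 'a \<Rightarrow> 'a \<Rightarrow> 'a \<Rightarrow> 'b::comm_monoid_add"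
  assumes "finite S"
  shows "(\<Sum>(i, j, k, l) \<in> {(i, j, k, l). {i, j, k, l} \<subseteq> S \<and> i < j \<and> j < k \<and> k < l}.
            \<Sum>\<pi> | \<pi> permutes {i, j, k, l}. g (\<pi> i) (\<pi> j) (\<pi> k) (\<pi> l))
       = (\<Sum>(i, j, k, l) \<in> distinct_quadruples S. g i j k l)"
proof -
  define Q where "Q = {(i, j, k, l). {i, j, k, l} \<subseteq> S \<and> i < j \<and> j < k \<and> k < l}"
  define P where "P = (\<lambda>(i, j, k, l). {\<pi>. \<pi> permutes {i, j, k, l :: 'a}})"
  define F where "F = (\<lambda>((i, j, k, l), \<pi> :: 'a \<Rightarrow> 'a). (\<pi> i, \<pi> j, \<pi> k, \<pi> l))"
  have finQ: "finite Q"
    by (rule finite_subset[of _ "S \<times> S \<times> S \<times> S"]) (use assms in \<open>auto simp: Q_def\<close>)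
  have finP: "\<forall>t\<in>Q. finite (P t)"
    by (auto simp: P_def intro!: finite_permutations)
  have inj: "inj_on F (Sigma Q P)"
  proof (rule inj_onI, clarify)
    fix i j k l \<pi> i' j' k' l' \<pi>'
    assume "(i, j, k, l) \<in> Q" "(i', j', k', l') \<in> Q"
      and P: "\<pi> \<in> P (i, j, k, l)" "\<pi>' \<in> P (i', j', k', l')"
      and F: "F ((i, j, k, l), \<pi>) = F ((i', j', k', l'), \<pi>')"
    then have ord: "i < j" "j < k" "k < l" "i' < j'" "j' < k'" "k' < l'"
      by (auto simp: Q_def)
    have perm: "\<pi> permutes {i, j, k, l}" "\<pi>' permutes {i', j', k', l'}"
      using P by (auto simp: P_def)
    have val: "\<pi> i = \<pi>' i'" "\<pi> j = \<pi>' j'" "\<pi> k = \<pi>' k'" "\<pi> l = \<pi>' l'"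
      using F by (auto simp: F_def)
    have "{i, j, k, l} = \<pi> ` {i, j, k, l}"
      using permutes_image[OF perm(1)] by simp
    also have "\<dots> = \<pi>' ` {i', j', k', l'}"
      using val by simp
    also have "\<dots> = {i', j', k', l'}"
      by (rule permutes_image[OF perm(2)])
    finally have sets: "{i, j, k, l} = {i', j', k', l'}" .
    have "[i, j, k, l] = [i', j', k', l']"
      by (rule strict_sorted_equal) (use ord sets in auto)
    then have eq: "i = i'" "j = j'" "k = k'" "l = l'"
      by simp_all
    have "\<pi> x = \<pi>' x" for x
    proof (cases "x \<in> {i, j, k, l}")
      case True
      then show ?thesis using val eq by auto
    next
      case False
      then show ?thesis using perm sets by (metis permutes_not_in)
    qed
    with eq show "((i, j, k, l) = (i', j', k', l')) \<and> \<pi> = \<pi>'"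
      by auto
  qed
  have image: "F ` Sigma Q P = distinct_quadruples S"
  proof (intro equalityI subsetI)
    fix t assume "t \<in> F ` Sigma Q P"
    then obtain i j k l \<pi> where t: "t = (\<pi> i, \<pi> j, \<pi> k, \<pi> l)" and q: "(i, j, k, l) \<in> Q"
      and perm: "\<pi> permutes {i, j, k, l}"
      by (auto simp: F_def P_def)
    have "distinct [\<pi> i, \<pi> j, \<pi> k, \<pi> l]"
      using q permutes_inj[OF perm] by (auto simp: Q_def inj_eq)
    moreover have "{\<pi> i, \<pi> j, \<pi> k, \<pi> l} = {i, j, k, l}"
      using permutes_image[OF perm] by simp
    ultimately show "t \<in> distinct_quadruples S"
      using q unfolding t distinct_quadruples_def Q_def by (simp del: insert_subset)
  next
    fix t assume "t \<in> distinct_quadruples S"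
    then obtain a b c d where t: "t = (a, b, c, d)" and S: "{a, b, c, d} \<subseteq> S"
      and dist: "distinct [a, b, c, d]"
      by (auto simp: distinct_quadruples_def)
    have "card {a, b, c, d} = 4"
      using distinct_card[OF dist] by simp
    then obtain i j k l where ord: "i < j" "j < k" "k < l" and sets: "{a, b, c, d} = {i, j, k, l}"
      by (rule ex_sorted_quadruple)
    have "distinct [i, j, k, l]"
      using ord by auto
    then obtain \<pi> where "\<pi> permutes {i, j, k, l}" "\<pi> i = a" "\<pi> j = b" "\<pi> k = c" "\<pi> l = d"
      using dist sets by (rule permutation_of_distinct_quadruple)
    moreover have "(i, j, k, l) \<in> Q"
      using S ord unfolding sets Q_def by simp
    ultimately show "t \<in> F ` Sigma Q P"
      unfolding t by (intro image_eqI[of _ _ "((i, j, k, l), \<pi>)"]) (auto simp: F_def P_def)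
  qed
  have "(\<Sum>(i, j, k, l)\<in>Q. \<Sum>\<pi> | \<pi> permutes {i, j, k, l}. g (\<pi> i) (\<pi> j) (\<pi> k) (\<pi> l))
      = (\<Sum>t\<in>Q. \<Sum>\<pi>\<in>P t. case F (t, \<pi>) of (i, j, k, l) \<Rightarrow> g i j k l)"
    by (intro sum.cong) (auto simp: P_def F_def)
  also have "\<dots> = (\<Sum>z\<in>Sigma Q P. case F z of (i, j, k, l) \<Rightarrow> g i j k l)"
    using sum.Sigma[OF finQ finP, of "\<lambda>t \<pi>. case F (t, \<pi>) of (i, j, k, l) \<Rightarrow> g i j k l"]
    by (simp add: case_prod_unfold)
  also have "\<dots> = (\<Sum>(i, j, k, l)\<in>distinct_quadruples S. g i j k l)"
    unfolding image[symmetric] by (simp add: sum.reindex[OF inj] comp_def)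
  finally show ?thesis
    unfolding Q_def .
qed

section \<open>Summing the kernel over distinct quadruples\<close>

text \<open>
  Terms with \<open>i = j\<close> or \<open>k = l\<close> are zero, so they may be added to make the ranges of \<open>i, j\<close> and
  of \<open>k, l\<close> into full squares; this is what lets the inner sum factor later.
\<close>

lemma sum_distinct_quadruples_pair_product:
  fixes f :: "'a \<Rightarrow> 'a \<Rightarrow> 'b::comm_semiring_0"
  assumes "finite S" and diag: "\<And>i. f i i = 0"
  shows "(\<Sum>(i, j, k, l)\<in>distinct_quadruples S. f i j * f k l)
       = (\<Sum>i\<in>S. \<Sum>j\<in>S. f i j * (\<Sum>k\<in>S - {i, j}. \<Sum>l\<in>S - {i, j}. f k l))"
proof -
  define D where "D = Sigma S (\<lambda>i. Sigma S (\<lambda>j. (S - {i, j}) \<times> (S - {i, j})))"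
  have "(\<Sum>i\<in>S. \<Sum>j\<in>S. f i j * (\<Sum>k\<in>S - {i, j}. \<Sum>l\<in>S - {i, j}. f k l))
      = (\<Sum>(i, j, k, l)\<in>D. f i j * f k l)"
    using assms(1) unfolding D_def
    by (simp add: sum_distrib_left sum.Sigma case_prod_unfold)
  also have "\<dots> = (\<Sum>(i, j, k, l)\<in>distinct_quadruples S. f i j * f k l)"
    by (rule sum.mono_neutral_right)
      (use assms in \<open>auto simp: D_def distinct_quadruples_def\<close>)
  finally show ?thesis ..
qed

text \<open>
  The combinatorial core. Idempotence of \<open>a\<close> and \<open>b\<close> is what closes the computation: it reduces
  every monomial that arises to a squarefree one, and the sums of these over all pairs of indices
  are products of two of \<open>n\<close>, \<open>A\<close>, \<open>B\<close> and \<open>C\<close>.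
\<close>

lemma sum_distinct_quadruples_indicator_kernel:
  fixes a b :: "'a \<Rightarrow> real"
  assumes fin: "finite S"
    and idem_a: "\<And>i. a i * a i = a i" and idem_b: "\<And>i. b i * b i = b i"
  defines "A \<equiv> \<Sum>i\<in>S. a i" and "B \<equiv> \<Sum>i\<in>S. b i" and "C \<equiv> \<Sum>i\<in>S. a i * b i"
    and "n \<equiv> real (card S)"
  shows "(\<Sum>(i, j, k, l)\<in>distinct_quadruples S.
            (a i * b i - a i * b j) * (a k * b k - a k * b l))
       = (n - 1) * (n - 2) * (C\<^sup>2 - C) + (A\<^sup>2 - A) * (B\<^sup>2 - B)
         - 2 * (n - 1) * (C * (A * B - A - B + 1))"
proof -
  define inner where "inner = (\<lambda>i j.
    (n - 2) * (C - a i * b i - a j * b j) - (A - a i - a j) * (B - b i - b j))"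
  have drop: "(\<Sum>k\<in>S - {i, j}. h k) = (\<Sum>k\<in>S. h k) - h i - h j"
    if "i \<in> S" "j \<in> S" "i \<noteq> j" for h :: "'a \<Rightarrow> real" and i j
  proof -
    have "S - {i, j} = S - {i} - {j}" by auto
    then show ?thesis using that fin by (simp add: sum_diff1)
  qed
  have inner: "(\<Sum>k\<in>S - {i, j}. \<Sum>l\<in>S - {i, j}. a k * b k - a k * b l) = inner i j"
    if "i \<in> S" "j \<in> S" "i \<noteq> j" for i j
  proof -
    have "real (card (S - {i, j})) = n - 2"
      using drop[OF that, of "\<lambda>_. 1"] by (simp add: n_def)
    then have "(\<Sum>k\<in>S - {i, j}. \<Sum>l\<in>S - {i, j}. a k * b k - a k * b l)
        = (n - 2) * (\<Sum>k\<in>S - {i, j}. a k * b k) - (\<Sum>k\<in>S - {i, j}. a k) * (\<Sum>l\<in>S - {i, j}. b l)"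
      unfolding sum_product by (simp add: sum_subtractf sum_distrib_left)
    also have "\<dots> = inner i j"
      unfolding inner_def A_def B_def C_def by (simp add: drop[OF that])
    finally show ?thesis .
  qed
  \<comment> \<open>The two sides of the expansion agree as polynomials modulo \<open>a\<^sup>2 = a\<close> and \<open>b\<^sup>2 = b\<close>,
    so it is enough to compare them at the sixteen points with coordinates zero and one.\<close>
  have zero_one: "a i = 0 \<or> a i = 1" "b i = 0 \<or> b i = 1" for i
    using idem_a[of i] idem_b[of i] by auto
  have expand: "(a i * b i - a i * b j) * inner i j
      = ((n - 2) * C - A * B + A + B - n + 1) * (a i * b i)
      + (A * B - (n - 2) * C - A - B + 1) * (a i * b j)
      + (n - 2) * (a i * b i * b j) + (B - 1) * (a i * b i * a j)
      + (n - 1 - B) * (a i * (a j * b j)) - (n - 2) * (a i * b i * (a j * b j))" for i j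
    using zero_one[of i] zero_one[of j]
    by (elim disjE) (simp_all add: inner_def algebra_simps)
  have monomials:
    "(\<Sum>i\<in>S. \<Sum>j\<in>S. a i * b i) = n * C"
    "(\<Sum>i\<in>S. \<Sum>j\<in>S. a i * b j) = A * B"
    "(\<Sum>i\<in>S. \<Sum>j\<in>S. a i * b i * b j) = C * B"
    "(\<Sum>i\<in>S. \<Sum>j\<in>S. a i * b i * a j) = C * A"
    "(\<Sum>i\<in>S. \<Sum>j\<in>S. a i * (a j * b j)) = A * C"
    "(\<Sum>i\<in>S. \<Sum>j\<in>S. a i * b i * (a j * b j)) = C * C"
    unfolding A_def B_def C_def sum_product by (simp_all add: n_def sum_distrib_left)
  have scale: "(\<Sum>i\<in>S. \<Sum>j\<in>S. c * h i j) = c * (\<Sum>i\<in>S. \<Sum>j\<in>S. h i j)"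
    for c :: real and h
    by (simp add: sum_distrib_left)
  have "(\<Sum>(i, j, k, l)\<in>distinct_quadruples S. (a i * b i - a i * b j) * (a k * b k - a k * b l))
      = (\<Sum>i\<in>S. \<Sum>j\<in>S. (a i * b i - a i * b j)
           * (\<Sum>k\<in>S - {i, j}. \<Sum>l\<in>S - {i, j}. a k * b k - a k * b l))"
    by (rule sum_distinct_quadruples_pair_product[OF fin]) simp
  also have "\<dots> = (\<Sum>i\<in>S. \<Sum>j\<in>S. (a i * b i - a i * b j) * inner i j)"
  proof (intro sum.cong refl)
    fix i j assume "i \<in> S" "j \<in> S"
    \<comment> \<open>For \<open>i = j\<close> the inner sums may differ, but the factor in front of them is zero.\<close>
    then show "(a i * b i - a i * b j)
          * (\<Sum>k\<in>S - {i, j}. \<Sum>l\<in>S - {i, j}. a k * b k - a k * b l)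
        = (a i * b i - a i * b j) * inner i j"
      using inner by (cases "i = j") simp_all
  qed
  also have "\<dots> = ((n - 2) * C - A * B + A + B - n + 1) * (n * C)
      + (A * B - (n - 2) * C - A - B + 1) * (A * B)
      + (n - 2) * (C * B) + (B - 1) * (C * A) + (n - 1 - B) * (A * C) - (n - 2) * (C * C)"
    by (simp only: expand sum.distrib sum_subtractf scale monomials)
  also have "\<dots> = (n - 1) * (n - 2) * (C\<^sup>2 - C) + (A\<^sup>2 - A) * (B\<^sup>2 - B)
         - 2 * (n - 1) * (C * (A * B - A - B + 1))"
    by (simp add: power2_eq_square algebra_simps)
  finally show ?thesis .
qed

section \<open>Contingency table counts and the U-statistic\<close>

text \<open>
  A row total adds up only the cells of the table; that it counts every \<open>i\<close> with \<open>X i = q\<close> is where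
  the assumption that the data lie in the table enters.
\<close>

lemma row_count_eq_marginal:
  assumes "\<And>i. i \<in> {1..\<sigma>} \<Longrightarrow> Y i \<in> {1..l2}"
  shows "row_count \<sigma> l2 X Y q = (\<Sum>i=1..\<sigma>. of_bool (X i = q))"
proof -
  have "(\<Sum>r=1..l2. of_bool (X i = q) * of_bool (Y i = r)) = (of_bool (X i = q) :: real)"
    if "i \<in> {1..\<sigma>}" for i
    using assms[OF that] by (simp add: sum_distrib_left[symmetric] of_bool_def)
  then show ?thesis
    unfolding row_count_def cell_count_def by (subst sum.swap) (rule sum.cong[OF refl])
qed

lemma col_count_eq_marginal:
  assumes "\<And>i. i \<in> {1..\<sigma>} \<Longrightarrow> X i \<in> {1..l1}"
  shows "col_count \<sigma> l1 X Y r = (\<Sum>i=1..\<sigma>. of_bool (Y i = r))"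
proof -
  have "(\<Sum>q=1..l1. of_bool (X i = q) * of_bool (Y i = r)) = (of_bool (Y i = r) :: real)"
    if "i \<in> {1..\<sigma>}" for i
    using assms[OF that] by (simp add: sum_distrib_right[symmetric] of_bool_def)
  then show ?thesis
    unfolding col_count_def cell_count_def by (subst sum.swap) (rule sum.cong[OF refl])
qed

lemma choose_four_times_fact:
  "fact 4 * real (n choose 4) = real n * (real n - 1) * (real n - 2) * (real n - 3)"
proof -
  have "real (n choose 4) = (real n - 0) * (real n - 1) * (real n - 2) * (real n - 3) / fact 4"
    unfolding binomial_gbinomial gbinomial_prod_rev by (simp add: eval_nat_numeral)
  then show ?thesis by simp
qed

lemma U_W_eq_average_distinct:
  "U_W \<sigma> l1 l2 X Y \<eta> \<upsilon> =
     (\<Sum>q=1..l1. \<Sum>r=1..l2.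
        (\<Sum>(i, j, k, l)\<in>distinct_quadruples {1..\<sigma>}. phi X Y i j q r * phi X Y k l q r)
          / (\<eta> q * \<upsilon> r))
     / (real \<sigma> * (real \<sigma> - 1) * (real \<sigma> - 2) * (real \<sigma> - 3))"
proof -
  define g where "g = (\<lambda>i j k l. \<Sum>q=1..l1. \<Sum>r=1..l2.
    phi X Y i j q r * phi X Y k l q r / (\<eta> q * \<upsilon> r))"
  have quads: "{(i, j, k, l). 1 \<le> i \<and> i < j \<and> j < k \<and> k < l \<and> l \<le> \<sigma>}
      = {(i, j, k, l). {i, j, k, l} \<subseteq> {1..\<sigma>} \<and> i < j \<and> j < k \<and> k < l}"
    by auto
  have kernel: "kernel_h l1 l2 X Y \<eta> \<upsilon> i j k l
      = 1 / fact 4 * (\<Sum>\<pi> | \<pi> permutes {i, j, k, l}. g (\<pi> i) (\<pi> j) (\<pi> k) (\<pi> l))" for i j k l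
    by (simp only: kernel_h_def g_def)
  have "U_W \<sigma> l1 l2 X Y \<eta> \<upsilon> = inverse (real (\<sigma> choose 4)) * (1 / fact 4 *
      (\<Sum>(i, j, k, l) \<in> {(i, j, k, l). {i, j, k, l} \<subseteq> {1..\<sigma>} \<and> i < j \<and> j < k \<and> k < l}.
         \<Sum>\<pi> | \<pi> permutes {i, j, k, l}. g (\<pi> i) (\<pi> j) (\<pi> k) (\<pi> l)))"
    unfolding U_W_def quads kernel by (simp only: sum_distrib_left case_prod_unfold)
  also have "\<dots> = (\<Sum>(i, j, k, l)\<in>distinct_quadruples {1..\<sigma>}. g i j k l)
      / (fact 4 * real (\<sigma> choose 4))"
    unfolding sum_increasing_quadruples_permutes[OF finite_atLeastAtMost]
    by (simp add: divide_simps)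
  also have "(\<Sum>(i, j, k, l)\<in>distinct_quadruples {1..\<sigma>}. g i j k l)
      = (\<Sum>q=1..l1. \<Sum>r=1..l2.
          (\<Sum>(i, j, k, l)\<in>distinct_quadruples {1..\<sigma>}. phi X Y i j q r * phi X Y k l q r)
            / (\<eta> q * \<upsilon> r))"
    unfolding g_def case_prod_unfold
    by (simp add: sum.swap[of _ _ "distinct_quadruples _"] sum_divide_distrib)
  finally show ?thesis
    unfolding choose_four_times_fact .
qed

lemma of_bool_idem: "of_bool P * of_bool P = (of_bool P :: real)"
  by simp

lemma sum_distinct_quadruples_phi:
  assumes "\<And>i. i \<in> {1..\<sigma>} \<Longrightarrow> X i \<in> {1..l1}"
    and "\<And>i. i \<in> {1..\<sigma>} \<Longrightarrow> Y i \<in> {1..l2}"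
  defines "n \<equiv> real \<sigma>" and "C \<equiv> cell_count \<sigma> X Y" and "A \<equiv> row_count \<sigma> l2 X Y"
    and "B \<equiv> col_count \<sigma> l1 X Y"
  shows "(\<Sum>(i, j, k, l)\<in>distinct_quadruples {1..\<sigma>}. phi X Y i j q r * phi X Y k l q r)
       = (n - 1) * (n - 2) * ((C q r)\<^sup>2 - C q r) + ((A q)\<^sup>2 - A q) * ((B r)\<^sup>2 - B r)
         - 2 * (n - 1) * (C q r * (A q * B r - A q - B r + 1))"
proof -
  have "A q = (\<Sum>i=1..\<sigma>. of_bool (X i = q))"
    unfolding A_def using assms(2) by (rule row_count_eq_marginal)
  moreover have "B r = (\<Sum>i=1..\<sigma>. of_bool (Y i = r))"
    unfolding B_def using assms(1) by (rule col_count_eq_marginal)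
  moreover have "n = real (card {1..\<sigma>})"
    by (simp add: n_def)
  ultimately show ?thesis
    unfolding C_def cell_count_def phi_def
    by (simp only: sum_distinct_quadruples_indicator_kernel finite_atLeastAtMost of_bool_idem)
qed

theorem proposition1:
  fixes \<sigma> l1 l2 :: nat
    and X Y :: "nat \<Rightarrow> nat"
    and \<eta> \<upsilon> :: "nat \<Rightarrow> real"
  assumes "l1 \<ge> 1" and "l2 \<ge> 1" and "\<sigma> \<ge> 4"
    and "\<And>i. i \<in> {1..\<sigma>} \<Longrightarrow> X i \<in> {1..l1}"
    and "\<And>i. i \<in> {1..\<sigma>} \<Longrightarrow> Y i \<in> {1..l2}"
    and "\<And>q. q \<in> {1..l1} \<Longrightarrow> \<eta> q \<noteq> 0"
    and "\<And>r. r \<in> {1..l2} \<Longrightarrow> \<upsilon> r \<noteq> 0"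
  shows "U_W \<sigma> l1 l2 X Y \<eta> \<upsilon> =
    1 / (real \<sigma> * (real \<sigma> - 3)) *
      (A1 \<sigma> l1 l2 X Y \<eta> \<upsilon>
       + 1 / ((real \<sigma> - 1) * (real \<sigma> - 2)) * A2 \<sigma> l1 l2 X Y \<eta> \<upsilon>
       - 2 / (real \<sigma> - 2) * A3 \<sigma> l1 l2 X Y \<eta> \<upsilon>)"
proof -
  define n where "n = real \<sigma>"
  have n: "n \<noteq> 0" "n - 1 \<noteq> 0" "n - 2 \<noteq> 0" "n - 3 \<noteq> 0"
    using assms(3) by (auto simp: n_def)
  \<comment> \<open>The factors are kept opaque: expanding the products would hide what cancels.\<close>
  have cancel: "(u * v * x + y - 2 * u * z) / (m * u * v * w)
      = 1 / (m * w) * (x + 1 / (u * v) * y - 2 / v * z)"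
    if "m \<noteq> 0" "u \<noteq> 0" "v \<noteq> 0" "w \<noteq> 0" for m u v w x y z :: real
    using that by (simp add: field_simps)
  have A2: "A2 \<sigma> l1 l2 X Y \<eta> \<upsilon> = (\<Sum>q=1..l1. \<Sum>r=1..l2.
      ((row_count \<sigma> l2 X Y q)\<^sup>2 - row_count \<sigma> l2 X Y q)
      * ((col_count \<sigma> l1 X Y r)\<^sup>2 - col_count \<sigma> l1 X Y r) / (\<eta> q * \<upsilon> r))"
    unfolding A2_def sum_product by simp
  have total: "(\<Sum>(i, j, k, l)\<in>distinct_quadruples {1..\<sigma>}. phi X Y i j q r * phi X Y k l q r)
      = (n - 1) * (n - 2) * ((cell_count \<sigma> X Y q r)\<^sup>2 - cell_count \<sigma> X Y q r)
        + ((row_count \<sigma> l2 X Y q)\<^sup>2 - row_count \<sigma> l2 X Y q)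
          * ((col_count \<sigma> l1 X Y r)\<^sup>2 - col_count \<sigma> l1 X Y r)
        - 2 * (n - 1) * (cell_count \<sigma> X Y q r
          * (row_count \<sigma> l2 X Y q * col_count \<sigma> l1 X Y r
             - row_count \<sigma> l2 X Y q - col_count \<sigma> l1 X Y r + 1))" for q r
    unfolding n_def using assms(4,5) by (rule sum_distinct_quadruples_phi)
  have "U_W \<sigma> l1 l2 X Y \<eta> \<upsilon>
      = ((n - 1) * (n - 2) * A1 \<sigma> l1 l2 X Y \<eta> \<upsilon> + A2 \<sigma> l1 l2 X Y \<eta> \<upsilon>
         - 2 * (n - 1) * A3 \<sigma> l1 l2 X Y \<eta> \<upsilon>) / (n * (n - 1) * (n - 2) * (n - 3))"
    unfolding U_W_eq_average_distinct total A2 A1_def A3_def n_def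
      sum_distrib_left times_divide_eq_right
    by (simp only: add_divide_distrib diff_divide_distrib sum.distrib sum_subtractf)
  also have "\<dots> = 1 / (n * (n - 3)) *
      (A1 \<sigma> l1 l2 X Y \<eta> \<upsilon> + 1 / ((n - 1) * (n - 2)) * A2 \<sigma> l1 l2 X Y \<eta> \<upsilon>
       - 2 / (n - 2) * A3 \<sigma> l1 l2 X Y \<eta> \<upsilon>)"
    using n by (rule cancel)
  finally show ?thesis
    unfolding n_def .
qed

end
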